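(* Let $K\subseteq\mathbb{R}^n$ be a closed proper convex cone with nonempty interior, $g:[0,\pi]\to\mathbb{R}$ continuous, strictly increasing, and convex on $[0,\pi/2]$, and $\psi(w)=\int_{K_1} g(\rho(w,y))\,d\sigma(y)$ for $w\in\mathcal{S}^{n-1}$. Then $\psi$ has a unique global minimum point on $\mathcal{S}^{n-1}$, and this point is the only local minimum point of $\psi$ outside $-\hat K$.
   Context: $\mathcal{S}^{n-1}$ is the Euclidean unit sphere in $\mathbb{R}^n$, $\sigma$ the normalized uniform measure on it, $\rho(w,y)=\arccos\langle w,y\rangle$ the geodesic distance. For $A\subseteq\mathbb{R}^n$, $A_1=A\cap\mathcal{S}^{n-1}$ and $\hat A=\{x\in\mathbb{R}^n:\langle x,v\rangle\ge 0\ \forall v\in A\}$. A convex cone is proper if it is contained in some closed halfspace through the origin. *)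

theory Defs
  imports "HOL-Analysis.Analysis"
begin

text \<open>Normalized uniform measure sigma on the unit sphere, realised as the image of the
  normalized Lebesgue measure on the unit ball under radial projection x / norm x
  (the cone-measure construction; it coincides with normalized surface measure).\<close>
definition sphere_measure :: "'a::euclidean_space measure" where
  "sphere_measure = distr (uniform_measure lborel (ball 0 1)) borel (\<lambda>x. x /\<^sub>R norm x)"

definition geo_dist :: "'a::euclidean_space \<Rightarrow> 'a \<Rightarrow> real" where
  "geo_dist w y = arccos (w \<bullet> y)"

definition dual_cone :: "'a::euclidean_space set \<Rightarrow> 'a set" where
  "dual_cone A = {x. \<forall>v\<in>A. x \<bullet> v \<ge> 0}"

definition proper_cone :: "'a::euclidean_space set \<Rightarrow> bool" where
  "proper_cone K \<longleftrightarrow> (\<exists>v. v \<noteq> 0 \<and> K \<subseteq> {x. v \<bullet> x \<ge> 0})"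

definition psi :: "'a::euclidean_space set \<Rightarrow> (real \<Rightarrow> real) \<Rightarrow> 'a \<Rightarrow> real" where
  "psi K g w = (\<integral>y \<in> K \<inter> sphere 0 1. g (geo_dist w y) \<partial>sphere_measure)"

definition sphere_local_min :: "('a::euclidean_space \<Rightarrow> real) \<Rightarrow> 'a \<Rightarrow> bool" where
  "sphere_local_min f w \<longleftrightarrow> w \<in> sphere 0 1 \<and>
     (\<exists>e>0. \<forall>u\<in>sphere 0 1. dist u w < e \<longrightarrow> f w \<le> f u)"

definition sphere_global_min :: "('a::euclidean_space \<Rightarrow> real) \<Rightarrow> 'a \<Rightarrow> bool" where
  "sphere_global_min f w \<longleftrightarrow> w \<in> sphere 0 1 \<and> (\<forall>u\<in>sphere 0 1. f w \<le> f u)"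

end

theory Submission
  imports Defs
begin

text \<open>If two unit vectors satisfy \<open>w' - w \<in> interior K\<close>, the reflection that swaps them maps the part
  of \<open>K\<close> on the side of \<open>w\<close> into \<open>K\<close>, so \<open>psi w' < psi w\<close>. If \<open>w' - w\<close> is a nonzero element of the
  dual cone, every point of \<open>K\<close> is at least as close to \<open>w'\<close> as to \<open>w\<close>, so again \<open>psi w' < psi w\<close>.
  When \<open>w\<close> has both positive and negative inner products with one of these two cones, such \<open>w'\<close>
  exist arbitrarily close to \<open>w\<close>. Hence a local minimum outside the negative dual cone lies in the
  dual cone (first case) and then in \<open>K\<close> (second case). From there all points of \<open>K\<close> are within
  distance \<open>\<pi>/2\<close>, where convexity of \<open>g\<close> along geodesics excludes a second local minimum. A global
  minimum exists by compactness, and is outside the negative dual cone because for \<open>w\<close> in it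
  \<open>psi (- w) < psi w\<close>.\<close>

section \<open>Lebesgue measure: isometry invariance and strict monotonicity of the integral\<close>

lemma nn_integral_lborel_translation:
  fixes f :: "'a::euclidean_space \<Rightarrow> ennreal"
  assumes [measurable]: "f \<in> borel_measurable borel"
  shows "(\<integral>\<^sup>+x. f (c + x) \<partial>lborel) = (\<integral>\<^sup>+x. f x \<partial>lborel)"
proof -
  have "(\<integral>\<^sup>+x. f x \<partial>lborel) = (\<integral>\<^sup>+x. f x \<partial>distr lborel borel ((+) c))"
    by (simp only: lborel_distr_plus)
  also have "\<dots> = (\<integral>\<^sup>+x. f (c + x) \<partial>lborel)"
    by (subst nn_integral_distr) auto
  finally show ?thesis ..
qed

text \<open>Uniqueness of Haar measure, in the form needed: compute the measure of the pairs
  \<open>(x, z)\<close> with \<open>norm x < 1\<close> and \<open>x + T z \<in> B\<close> in both orders. Both the unit ball and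
  Lebesgue measure are insensitive to the translations that occur.\<close>
lemma lborel_distr_orthogonal_transformation:
  fixes T :: "'a::euclidean_space \<Rightarrow> 'a"
  assumes T: "orthogonal_transformation T"
  shows "distr lborel borel T = lborel"
proof (rule measure_eqI)
  show "sets (distr lborel borel T) = sets lborel" by simp
next
  fix B assume "B \<in> sets (distr lborel borel T)"
  then have B[measurable]: "B \<in> sets borel" by simp
  have linT: "linear T" using T by (rule orthogonal_transformation_linear)
  have T_meas[measurable]: "T \<in> borel_measurable borel"
    using linT by (intro borel_measurable_continuous_onI linear_continuous_on)
      (simp add: linear_conv_bounded_linear)
  have surjT: "surj T" using T by (rule orthogonal_transformation_surj)
  define b where "b = emeasure lborel (ball (0::'a) 1)"
  let ?A = "ball (0::'a) 1"
  have A_meas[measurable]: "?A \<in> sets borel" by simp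
  have sets_pair: "sets (lborel \<Otimes>\<^sub>M lborel) = sets (borel \<Otimes>\<^sub>M (borel :: 'a measure))"
    by (intro sets_pair_measure_cong) auto
  have ind: "(\<integral>\<^sup>+x. indicator ?A x * c \<partial>lborel) = b * c" for c
    unfolding b_def by (subst nn_integral_multc) (auto intro!: borel_measurable_indicator)
  \<comment> \<open>The image measure is translation invariant: as \<open>T\<close> is onto,
    \<open>x = T u\<close>, and adding \<open>x\<close> after \<open>T\<close> amounts to adding
    \<open>u\<close> before it.\<close>
  have \<mu>_trans: "(\<integral>\<^sup>+z. indicator B (x + T z) \<partial>lborel) = emeasure (distr lborel borel T) B" for x
  proof -
    obtain u where u: "x = T u" using surjT by blast
    have "(\<integral>\<^sup>+z. indicator B (x + T z) \<partial>lborel)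
        = (\<integral>\<^sup>+z. indicator B (T (u + z)) \<partial>lborel)"
      by (simp add: u linear_add[OF linT])
    also have "\<dots> = (\<integral>\<^sup>+z. indicator B (T z) \<partial>lborel)"
      by (rule nn_integral_lborel_translation) simp
    also have "\<dots> = (\<integral>\<^sup>+z. indicator B z \<partial>distr lborel borel T)"
      by (subst nn_integral_distr) auto
    finally show ?thesis by simp
  qed
  \<comment> \<open>\<open>T\<close> preserves norms, so the \<open>z\<close> counted here form the
    unit ball around \<open>u\<close>, where \<open>x = T u\<close>.\<close>
  have ball_trans: "(\<integral>\<^sup>+z. indicator ?A (x - T z) \<partial>lborel) = b" for x
  proof -
    obtain u where u: "x = T u" using surjT by blast
    have eq: "norm (x - T z) = norm (- u + z)" for z
    proof -
      have "x - T z = T (u - z)" by (simp add: u linear_diff[OF linT])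
      then show ?thesis
        using orthogonal_transformation_norm[OF T, of "u - z"] by (simp add: norm_minus_commute)
    qed
    have "(\<integral>\<^sup>+z. indicator ?A (x - T z) \<partial>lborel) = (\<integral>\<^sup>+z. indicator ?A (- u + z) \<partial>lborel)"
      by (intro nn_integral_cong) (simp add: indicator_def eq del: add_uminus_conv_diff uminus_add_conv_diff)
    also have "\<dots> = (\<integral>\<^sup>+z. indicator ?A z \<partial>lborel)"
      by (rule nn_integral_lborel_translation) (auto intro!: borel_measurable_indicator)
    finally show ?thesis by (simp add: b_def)
  qed
  have "b * emeasure (distr lborel borel T) B
      = (\<integral>\<^sup>+x. indicator ?A x * (\<integral>\<^sup>+z. indicator B (x + T z) \<partial>lborel) \<partial>lborel)"
    by (simp only: \<mu>_trans ind)
  also have "\<dots> = (\<integral>\<^sup>+x. \<integral>\<^sup>+z. indicator ?A x * indicator B (x + T z) \<partial>lborel \<partial>lborel)"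
    by (subst nn_integral_cmult) auto
  also have "\<dots> = (\<integral>\<^sup>+z. \<integral>\<^sup>+x. indicator ?A x * indicator B (x + T z) \<partial>lborel \<partial>lborel)"
    by (rule lborel_pair.Fubini'[symmetric]) (simp add: measurable_cong_sets[OF sets_pair refl])
  also have "\<dots> = (\<integral>\<^sup>+z. \<integral>\<^sup>+x. indicator ?A (x - T z) * indicator B x \<partial>lborel \<partial>lborel)"
  proof (rule nn_integral_cong)
    fix z
    show "(\<integral>\<^sup>+x. indicator ?A x * indicator B (x + T z) \<partial>lborel)
        = (\<integral>\<^sup>+x. indicator ?A (x - T z) * indicator B x \<partial>lborel)"
      using nn_integral_lborel_translation[of "\<lambda>x. indicator ?A (x - T z) * indicator B x" "T z"]
      by (simp add: add.commute)
  qed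
  also have "\<dots> = (\<integral>\<^sup>+x. \<integral>\<^sup>+z. indicator ?A (x - T z) * indicator B x \<partial>lborel \<partial>lborel)"
    by (rule lborel_pair.Fubini') (simp add: measurable_cong_sets[OF sets_pair refl])
  also have "\<dots> = (\<integral>\<^sup>+x. b * indicator B x \<partial>lborel)"
    by (subst nn_integral_multc) (auto simp: ball_trans)
  also have "\<dots> = b * emeasure lborel B"
    by (subst nn_integral_cmult) auto
  finally have *: "b * emeasure (distr lborel borel T) B = b * emeasure lborel B" .
  \<comment> \<open>In \<open>ennreal\<close> a factor can be cancelled only if it is neither zero
    nor infinite.\<close>
  have "b \<noteq> 0" "b \<noteq> \<infinity>"
    using emeasure_lborel_ball_finite[of "0::'a" 1] content_ball_pos[of 1 "0::'a"]
    by (auto simp: b_def measure_def)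
  with * show "emeasure (distr lborel borel T) B = emeasure lborel B"
    by (simp add: ennreal_mult_cancel_left)
qed

lemma lborel_integral_orthogonal_transformation:
  fixes T :: "'a::euclidean_space \<Rightarrow> 'a" and f :: "'a \<Rightarrow> real"
  assumes T: "orthogonal_transformation T" and [measurable]: "f \<in> borel_measurable borel"
  shows "(\<integral>x. f (T x) \<partial>lborel) = (\<integral>x. f x \<partial>lborel)"
    and "integrable lborel (\<lambda>x. f (T x)) \<longleftrightarrow> integrable lborel f"
proof -
  have T_meas: "T \<in> lborel \<rightarrow>\<^sub>M borel"
    using orthogonal_transformation_linear[OF T]
    by (simp add: borel_measurable_continuous_onI linear_continuous_on linear_conv_bounded_linear)
  have "(\<integral>x. f x \<partial>lborel) = (\<integral>x. f x \<partial>distr lborel borel T)"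
    by (simp only: lborel_distr_orthogonal_transformation[OF T])
  also have "\<dots> = (\<integral>x. f (T x) \<partial>lborel)"
    by (rule integral_distr[OF T_meas]) simp
  finally show "(\<integral>x. f (T x) \<partial>lborel) = (\<integral>x. f x \<partial>lborel)" ..
  have "integrable lborel f \<longleftrightarrow> integrable (distr lborel borel T) f"
    by (simp only: lborel_distr_orthogonal_transformation[OF T])
  also have "\<dots> \<longleftrightarrow> integrable lborel (\<lambda>x. f (T x))"
    by (rule integrable_distr_eq[OF T_meas]) simp
  finally show "integrable lborel (\<lambda>x. f (T x)) \<longleftrightarrow> integrable lborel f" ..
qed

text \<open>If the integrals were not strictly ordered, the nonnegative function
  \<open>h - f\<close> would vanish almost everywhere, making \<open>U\<close> negligible; a
  nonempty open set is not.\<close>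

lemma lborel_integral_strict_mono:
  fixes f h :: "'a::euclidean_space \<Rightarrow> real"
  assumes f: "integrable lborel f" and h: "integrable lborel h"
    and le: "\<And>x. f x \<le> h x"
    and U: "open U" "U \<noteq> {}" and less: "\<And>x. x \<in> U \<Longrightarrow> f x < h x"
  shows "(\<integral>x. f x \<partial>lborel) < (\<integral>x. h x \<partial>lborel)"
proof (rule ccontr)
  assume "\<not> ?thesis"
  then have "(\<integral>x. h x - f x \<partial>lborel) \<le> 0" using f h by simp
  moreover have "(\<integral>x. h x - f x \<partial>lborel) \<ge> 0" using le by (intro integral_nonneg_AE) auto
  ultimately have "(\<integral>x. h x - f x \<partial>lborel) = 0" by simp
  then have "AE x in lborel. h x - f x = 0"
    using f h le by (subst (asm) integral_nonneg_eq_0_iff_AE) auto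
  then have "AE x in lborel. x \<notin> U" by eventually_elim (use less in force)
  then have "U \<in> null_sets lborel" using U by (subst AE_iff_null_sets) auto
  then have "negligible U" by (simp add: negligible_iff_null_sets null_sets_completionI)
  then show False using U open_not_negligible by blast
qed

section \<open>Reflections and short chords of the sphere\<close>

lemma reflection_orthogonal_transformation:
  fixes v :: "'a::euclidean_space"
  shows "orthogonal_transformation (\<lambda>x. x - (2 * (v \<bullet> x) / (v \<bullet> v)) *\<^sub>R v)"
proof (cases "v = 0")
  case True then show ?thesis by (simp add: orthogonal_transformation_def linear_iff)
next
  case False
  then have [simp]: "v \<bullet> v \<noteq> 0" by simp
  show ?thesis
    unfolding orthogonal_transformation_def
  proof (intro conjI allI)
    show "linear (\<lambda>x. x - (2 * (v \<bullet> x) / (v \<bullet> v)) *\<^sub>R v)"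
      by (rule linearI) (simp_all add: inner_simps algebra_simps add_divide_distrib)
    show "(x - (2 * (v \<bullet> x) / (v \<bullet> v)) *\<^sub>R v) \<bullet> (y - (2 * (v \<bullet> y) / (v \<bullet> v)) *\<^sub>R v) = x \<bullet> y" for x y
      by (simp add: inner_simps inner_commute field_simps)
  qed
qed

text \<open>\<open>z\<close> is orthogonal to \<open>w\<close>, and tilting it slightly towards \<open>v\<close> gives the chord of a short
  arc starting at \<open>w\<close>.\<close>
lemma short_chord_in_cone:
  fixes w :: "'a::euclidean_space"
  assumes add: "\<And>x y. x \<in> C \<Longrightarrow> y \<in> C \<Longrightarrow> x + y \<in> C"
    and scale: "\<And>c x. c > 0 \<Longrightarrow> x \<in> C \<Longrightarrow> c *\<^sub>R x \<in> C"
    and "0 \<notin> C" and u: "u \<in> C" "w \<bullet> u > 0" and v: "v \<in> C" "w \<bullet> v < 0"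
    and w: "norm w = 1" and "e > 0"
  obtains w' where "norm w' = 1" "dist w' w < e" "w' - w \<in> C"
proof -
  define z where "z = (- (w \<bullet> v)) *\<^sub>R u + (w \<bullet> u) *\<^sub>R v"
  have "z \<in> C" unfolding z_def using u v by (intro add scale) auto
  then have "z \<noteq> 0" using \<open>0 \<notin> C\<close> by auto
  \<comment> \<open>The expression is the length of the chord constructed below from the tilt
    \<open>d\<close>; it tends to 0 with \<open>d\<close>.\<close>
  have "((\<lambda>d. - 2 * d * (w \<bullet> v) / norm (z + d *\<^sub>R v)) \<longlongrightarrow> - 2 * 0 * (w \<bullet> v) / norm (z + 0 *\<^sub>R v)) (at_right 0)"
    using \<open>z \<noteq> 0\<close> by (intro tendsto_intros) auto
  then have "\<forall>\<^sub>F d in at_right 0. - 2 * d * (w \<bullet> v) / norm (z + d *\<^sub>R v) < e"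
    using \<open>e > 0\<close> by (intro order_tendstoD) auto
  moreover have "\<forall>\<^sub>F d in at_right (0::real). d > 0" by (simp add: eventually_at_right_less)
  ultimately have "\<forall>\<^sub>F d in at_right 0. d > 0 \<and> - 2 * d * (w \<bullet> v) / norm (z + d *\<^sub>R v) < e"
    by eventually_elim auto
  then obtain d where d: "d > 0" "- 2 * d * (w \<bullet> v) / norm (z + d *\<^sub>R v) < e"
    using eventually_happens[of _ "at_right (0::real)"] by auto
  define y where "y = z + d *\<^sub>R v"
  have y: "y \<in> C" unfolding y_def using \<open>z \<in> C\<close> v d by (intro add scale) auto
  then have "y \<noteq> 0" using \<open>0 \<notin> C\<close> by auto
  have wy: "w \<bullet> y = d * (w \<bullet> v)" by (simp add: y_def z_def inner_simps algebra_simps)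
  then have "w \<bullet> y < 0" using d v by (simp add: mult_pos_neg)
  \<comment> \<open>This is the nonzero root of \<open>norm (w + c *\<^sub>R y) = 1\<close>, that
    is, where the ray from \<open>w\<close> in direction \<open>y\<close> meets the sphere
    again.\<close>
  define c where "c = - 2 * (w \<bullet> y) / (norm y)\<^sup>2"
  have "c > 0" using \<open>w \<bullet> y < 0\<close> \<open>y \<noteq> 0\<close> by (simp add: c_def divide_neg_pos)
  show thesis
  proof
    have "(norm (w + c *\<^sub>R y))\<^sup>2 = (norm w)\<^sup>2 + c * (2 * (w \<bullet> y) + c * (norm y)\<^sup>2)"
      by (simp add: power2_norm_eq_inner inner_simps inner_commute algebra_simps)
    also have "\<dots> = 1" using \<open>y \<noteq> 0\<close> w by (simp add: c_def)
    finally show "norm (w + c *\<^sub>R y) = 1" by (simp add: power2_eq_1_iff) (smt (verit) norm_ge_zero)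
    have "norm (c *\<^sub>R y) = c * norm y" using \<open>c > 0\<close> by simp
    also have "\<dots> = - 2 * d * (w \<bullet> v) / norm y"
      using \<open>y \<noteq> 0\<close> by (simp add: c_def wy power2_eq_square)
    finally have "norm (c *\<^sub>R y) = - 2 * d * (w \<bullet> v) / norm y" .
    then show "dist (w + c *\<^sub>R y) w < e" using d by (simp add: dist_norm y_def)
    show "w + c *\<^sub>R y - w \<in> C" using scale[OF \<open>c > 0\<close> y] by simp
  qed
qed

section \<open>Convexity of the angle along great circles\<close>

text \<open>For \<open>h\<close> the scaled sinusoid, the second derivative of
  \<open>arccos h\<close> has the sign of \<open>h * (1 - h^2 - h'^2)\<close>. Since
  \<open>h^2 + h'^2\<close> is the constant \<open>r^2 * (a^2 + b^2) < 1\<close>, this is the sign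
  of \<open>h\<close>.\<close>

lemma convex_on_arccos_scaled_sinusoid:
  fixes a b r :: real
  assumes ab: "a\<^sup>2 + b\<^sup>2 \<le> 1" and r: "0 \<le> r" "r < 1"
    and nonneg: "\<And>t. t \<in> {s1..s2} \<Longrightarrow> a * cos t + b * sin t \<ge> 0"
  shows "convex_on {s1..s2} (\<lambda>t. arccos (r * (a * cos t + b * sin t)))"
proof -
  define h where "h t = r * (a * cos t + b * sin t)" for t
  define h' where "h' t = r * (b * cos t - a * sin t)" for t
  have sq: "(h t)\<^sup>2 + (h' t)\<^sup>2 = r\<^sup>2 * (a\<^sup>2 + b\<^sup>2)" for t
  proof -
    have "(h t)\<^sup>2 + (h' t)\<^sup>2 = r\<^sup>2 * (a\<^sup>2 + b\<^sup>2) * ((sin t)\<^sup>2 + (cos t)\<^sup>2)"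
      unfolding h_def h'_def by algebra
    then show ?thesis by simp
  qed
  have "r\<^sup>2 < 1" using r by (simp add: power_less_one_iff abs_square_less_1)
  then have lt: "r\<^sup>2 * (a\<^sup>2 + b\<^sup>2) < 1"
    using mult_left_mono[OF ab, of "r\<^sup>2"] by simp
  have h2: "(h t)\<^sup>2 < 1" for t using sq[of t] lt by (smt (verit) zero_le_power2)
  then have h1: "-1 < h t" "h t < 1" for t
    by (simp_all add: abs_square_less_1 abs_less_iff)
  have Dh: "(h has_real_derivative h' t) (at t)" for t
    unfolding h_def h'_def by (auto intro!: derivative_eq_intros simp: algebra_simps)
  have Dh': "(h' has_real_derivative - h t) (at t)" for t
    unfolding h_def h'_def by (auto intro!: derivative_eq_intros simp: algebra_simps)
  have D1: "((\<lambda>t. arccos (h t)) has_real_derivative - h' t / sqrt (1 - (h t)\<^sup>2)) (at t)" for t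
    by (rule derivative_eq_intros Dh refl h1)+ (simp add: field_simps)
  have D2: "((\<lambda>t. - h' t / sqrt (1 - (h t)\<^sup>2)) has_real_derivative
      h t * (1 - (h t)\<^sup>2 - (h' t)\<^sup>2) / ((1 - (h t)\<^sup>2) * sqrt (1 - (h t)\<^sup>2))) (at t)" for t
  proof -
    have p: "1 - (h t)\<^sup>2 > 0" using h2[of t] by simp
    define q where "q = sqrt (1 - (h t)\<^sup>2)"
    have q: "q > 0" "q * q = 1 - (h t)\<^sup>2" using p by (simp_all add: q_def)
    have "((\<lambda>t. - h' t / sqrt (1 - (h t)\<^sup>2)) has_real_derivative
       (h t * q - (- h' t) * (- h t * h' t / q)) / (q * q)) (at t)"
      unfolding q_def using p
      by (auto intro!: derivative_eq_intros Dh Dh' simp: field_simps)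
    moreover have "(h t * q - (- h' t) * (- h t * h' t / q)) / (q * q)
        = h t * (1 - (h t)\<^sup>2 - (h' t)\<^sup>2) / ((1 - (h t)\<^sup>2) * q)"
      unfolding q(2)[symmetric] using q(1) by (simp add: field_simps power2_eq_square)
    ultimately show ?thesis by (simp add: q_def)
  qed
  have "convex_on {s1..s2} (\<lambda>t. arccos (h t))"
  proof (rule f''_ge0_imp_convex[OF _ D1 D2])
    fix t assume "t \<in> {s1..s2}"
    then have "h t \<ge> 0" using nonneg r by (simp add: h_def)
    moreover have "1 - (h t)\<^sup>2 - (h' t)\<^sup>2 \<ge> 0" "1 - (h t)\<^sup>2 > 0"
      using sq[of t] lt h2[of t] by auto
    ultimately show "0 \<le> h t * (1 - (h t)\<^sup>2 - (h' t)\<^sup>2) / ((1 - (h t)\<^sup>2) * sqrt (1 - (h t)\<^sup>2))"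
      by simp
  qed simp
  then show ?thesis by (simp add: h_def)
qed

text \<open>At points where the sinusoid equals 1 the arccosine is not differentiable; hence the scaling
  by \<open>r < 1\<close> above and the limit \<open>r \<rightarrow> 1\<close> here.\<close>
lemma convex_on_arccos_sinusoid:
  fixes a b :: real
  assumes ab: "a\<^sup>2 + b\<^sup>2 \<le> 1"
    and nonneg: "\<And>t. t \<in> {s1..s2} \<Longrightarrow> a * cos t + b * sin t \<ge> 0"
  shows "convex_on {s1..s2} (\<lambda>t. arccos (a * cos t + b * sin t))"
proof (rule convex_onI)
  fix u x y :: real assume u: "0 < u" "u < 1" and xy: "x \<in> {s1..s2}" "y \<in> {s1..s2}"
  define h where "h t = a * cos t + b * sin t" for t
  have h2: "\<bar>h t\<bar> \<le> 1" for t
  proof -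
    have "(h t)\<^sup>2 + (b * cos t - a * sin t)\<^sup>2 = (a\<^sup>2 + b\<^sup>2) * ((sin t)\<^sup>2 + (cos t)\<^sup>2)"
      unfolding h_def by algebra
    then have "(h t)\<^sup>2 \<le> 1" using ab by simp (smt (verit) zero_le_power2)
    then show ?thesis by (simp add: abs_square_le_1)
  qed
  \<comment> \<open>Any sequence in \<open>[0, 1)\<close> with limit 1 would serve.\<close>
  define r where "r n = 1 - 1 / (real n + 1)" for n
  have r: "0 \<le> r n" "r n < 1" for n by (auto simp: r_def field_simps)
  have rlim: "r \<longlonglongrightarrow> 1"
    unfolding r_def using LIMSEQ_inverse_real_of_nat_add_minus[of 1] by (simp add: inverse_eq_divide add.commute)
  have lim: "(\<lambda>n. arccos (r n * h t)) \<longlonglongrightarrow> arccos (h t)" for t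
  proof (rule continuous_on_tendsto_compose[OF continuous_on_arccos'])
    show "(\<lambda>n. r n * h t) \<longlonglongrightarrow> h t" using tendsto_mult_right[OF rlim, of "h t"] by simp
    show "h t \<in> {-1..1}" using h2[of t] by auto
    show "\<forall>\<^sub>F n in sequentially. r n * h t \<in> {-1..1}"
    proof (intro always_eventually allI)
      fix n
      have "\<bar>r n * h t\<bar> \<le> 1 * 1" unfolding abs_mult using r[of n] h2[of t] by (intro mult_mono) auto
      then show "r n * h t \<in> {-1..1}" by auto
    qed
  qed
  have "arccos (h ((1 - u) *\<^sub>R x + u *\<^sub>R y)) \<le> (1 - u) * arccos (h x) + u * arccos (h y)"
  proof (rule LIMSEQ_le[OF lim tendsto_add[OF tendsto_mult_left[OF lim] tendsto_mult_left[OF lim]]],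
      intro exI allI impI)
    fix n :: nat
    show "arccos (r n * h ((1 - u) *\<^sub>R x + u *\<^sub>R y))
        \<le> (1 - u) * arccos (r n * h x) + u * arccos (r n * h y)"
      using convex_onD[OF convex_on_arccos_scaled_sinusoid[OF ab r[of n] nonneg, of s1 s2], of u x y]
        u xy
      unfolding h_def by auto
  qed
  then show "arccos (a * cos ((1 - u) *\<^sub>R x + u *\<^sub>R y) + b * sin ((1 - u) *\<^sub>R x + u *\<^sub>R y))
    \<le> (1 - u) * arccos (a * cos x + b * sin x) + u * arccos (a * cos y + b * sin y)"
    by (simp add: h_def)
qed simp

section \<open>Radial pull-back: the potential as an integral over the unit ball\<close>

lemma cosine_bound:
  fixes w x :: "'a::real_inner"
  assumes "norm w = 1"
  shows "\<bar>(w \<bullet> x) / norm x\<bar> \<le> 1"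
proof (cases "x = 0")
  case False
  then show ?thesis using Cauchy_Schwarz_ineq2[of w x] assms by (simp add: abs_divide)
qed simp

lemma small_scale_in_ball:
  fixes x :: "'a::real_normed_vector"
  obtains c where "c > 0" "c *\<^sub>R x \<in> ball 0 1"
proof (rule that)
  show "inverse (1 + norm x) > 0" by (simp add: add_pos_nonneg)
  have "norm x < 1 + norm x" "1 + norm x > 0" by (simp_all add: add_pos_nonneg)
  then show "inverse (1 + norm x) *\<^sub>R x \<in> ball 0 1" by (simp add: field_simps)
qed

lemma integrable_ball_const: "integrable lborel (\<lambda>x::'a::euclidean_space. indicator (ball 0 1) x * (c::real))"
  using emeasure_lborel_ball_finite[of "0::'a" 1]
  by (intro integrable_mult_left integrable_real_indicator) auto

text \<open>Clamping the cosine makes the cost continuous and bounded on all of \<open>\<real>\<close>, although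
  \<open>g\<close> is unconstrained outside \<open>[0, \<pi>]\<close>.\<close>
definition angle_cost :: "(real \<Rightarrow> real) \<Rightarrow> real \<Rightarrow> real" where
  "angle_cost g t = g (arccos (max (-1) (min 1 t)))"

text \<open>Up to the volume of the ball this is \<open>psi\<close>, pulled back from the sphere to the ball.\<close>
definition cone_potential :: "'a::euclidean_space set \<Rightarrow> (real \<Rightarrow> real) \<Rightarrow> 'a \<Rightarrow> real" where
  "cone_potential K g w =
     (\<integral>x. indicator (K \<inter> ball 0 1) x * angle_cost g ((w \<bullet> x) / norm x) \<partial>lborel)"

section \<open>Solid proper cones and their duals\<close>

locale solid_proper_cone =
  fixes K :: "'a::euclidean_space set"
  assumes closed_K: "closed K" and cone_K: "convex_cone K" and proper_K: "proper_cone K"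
    and solid_K: "interior K \<noteq> {}"
begin

lemma add_mem: "x \<in> K \<Longrightarrow> y \<in> K \<Longrightarrow> x + y \<in> K"
  using cone_K by (rule convex_cone_add)

lemma scale_mem: "x \<in> K \<Longrightarrow> 0 \<le> c \<Longrightarrow> c *\<^sub>R x \<in> K"
  using cone_K by (simp add: convex_cone_scaleR)

lemma zero_mem: "0 \<in> K"
  using cone_K by (rule convex_cone_contains_0)

lemma scale_mem_iff: "c > 0 \<Longrightarrow> c *\<^sub>R x \<in> K \<longleftrightarrow> x \<in> K"
  using scale_mem[of x c] scale_mem[of "c *\<^sub>R x" "inverse c"] by auto

text \<open>The translate of \<open>interior K\<close> by \<open>y\<close> is an open subset of
  \<open>K\<close>.\<close>

lemma interior_add:
  assumes "x \<in> interior K" "y \<in> K"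
  shows "x + y \<in> interior K"
proof (rule interiorI)
  show "open ((+) y ` interior K)" by (intro open_translation open_interior)
  show "x + y \<in> (+) y ` interior K" using assms by (auto simp: add.commute)
  show "(+) y ` interior K \<subseteq> K" using assms interior_subset by (auto intro!: add_mem)
qed

lemma interior_scale:
  assumes "x \<in> interior K" "c > 0"
  shows "c *\<^sub>R x \<in> interior K"
proof (rule interiorI)
  show "open ((*\<^sub>R) c ` interior K)" using assms by (intro open_scaling open_interior) auto
  show "c *\<^sub>R x \<in> (*\<^sub>R) c ` interior K" using assms by auto
  show "(*\<^sub>R) c ` interior K \<subseteq> K" using assms interior_subset by (auto intro!: scale_mem)
qed

text \<open>From an interior point one can move a distance \<open>e\<close> against \<open>u\<close>
  without leaving \<open>K\<close>; this lowers the inner product with \<open>u\<close> by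
  \<open>e * norm u\<close>, and it is still nonnegative.\<close>

lemma dual_interior_pos:
  assumes u: "u \<in> dual_cone K" "u \<noteq> 0" and x: "x \<in> interior K"
  shows "u \<bullet> x > 0"
proof -
  obtain e where e: "e > 0" "cball x e \<subseteq> K" using x by (meson mem_interior_cball)
  define y where "y = x - (e / norm u) *\<^sub>R u"
  have "y \<in> cball x e" using u e by (simp add: y_def dist_norm)
  then have "u \<bullet> y \<ge> 0" using u e by (auto simp: dual_cone_def)
  moreover have "u \<bullet> y = u \<bullet> x - e * norm u"
    using u by (simp add: y_def inner_simps power2_norm_eq_inner[symmetric] power2_eq_square)
  moreover have "e * norm u > 0" using u e by simp
  ultimately show ?thesis by linarith
qed

lemma dual_nontrivial: obtains p where "p \<in> dual_cone K" "p \<noteq> 0"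
  using proper_K by (auto simp: proper_cone_def dual_cone_def)

text \<open>Properness provides a nonzero dual vector, which is positive at \<open>x\<close> and
  hence negative at \<open>- x\<close>.\<close>

lemma minus_interior_not_mem:
  assumes "x \<in> interior K" shows "- x \<notin> K"
proof
  assume "- x \<in> K"
  obtain p where p: "p \<in> dual_cone K" "p \<noteq> 0" by (rule dual_nontrivial)
  then have "p \<bullet> x > 0" using assms by (rule dual_interior_pos)
  moreover have "p \<bullet> (- x) \<ge> 0" using p \<open>- x \<in> K\<close> unfolding dual_cone_def by blast
  ultimately show False by simp
qed

lemma zero_not_interior: "0 \<notin> interior K"
  using minus_interior_not_mem[of 0] zero_mem by auto

text \<open>A closed convex set with nonempty interior is the closure of its interior. This allows a
  strict inequality at a point of \<open>K\<close> to be carried over to an interior point.\<close>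

lemma open_meets_interior:
  assumes "open U" "x \<in> K" "x \<in> U"
  shows "U \<inter> interior K \<noteq> {}"
proof -
  have "convex K" using cone_K by (simp add: convex_cone_def)
  then have "closure (interior K) = K"
    using convex_closure_interior[of K] solid_K closed_K by simp
  then show ?thesis using assms open_Int_closure_eq_empty[of U "interior K"] by auto
qed

text \<open>The normal \<open>a\<close> of a hyperplane strictly separating \<open>w\<close> from
  \<open>K\<close> works: the bound \<open>b\<close> is negative because \<open>0 \<in> K\<close>,
  and invariance under scaling improves the bound on \<open>K\<close> from \<open>b\<close> to
  0.\<close>

lemma separate_by_dual:
  assumes "w \<notin> K"
  obtains v where "v \<in> dual_cone K" "w \<bullet> v < 0"
proof -
  have "convex K" using cone_K by (simp add: convex_cone_def)
  then obtain a b where ab: "a \<bullet> w < b" "\<forall>x\<in>K. a \<bullet> x > b"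
    using separating_hyperplane_closed_point[of K w] closed_K assms by auto
  have "b < 0" using ab(2) zero_mem by force
  have "a \<bullet> x \<ge> 0" if x: "x \<in> K" for x
  proof (rule ccontr)
    assume neg: "\<not> ?thesis"
    \<comment> \<open>The factor is chosen so that \<open>a\<close> takes exactly the value
      \<open>b\<close> at the scaled point, against the strict bound.\<close>
    then have "(b / (a \<bullet> x)) *\<^sub>R x \<in> K" using x \<open>b < 0\<close>
      by (intro scale_mem) (auto simp: divide_nonpos_neg)
    then have "a \<bullet> ((b / (a \<bullet> x)) *\<^sub>R x) > b" using ab by blast
    then show False using neg by simp
  qed
  then show thesis
    using that[of a] ab \<open>b < 0\<close> by (simp add: dual_cone_def inner_commute)
qed

end

section \<open>Cost and potential: monotonicity, integrability, continuity\<close>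

locale cone_potential_setup = solid_proper_cone K for K :: "'a::euclidean_space set" +
  fixes g :: "real \<Rightarrow> real"
  assumes cont_g: "continuous_on {0..pi} g" and mono_g: "strict_mono_on {0..pi} g"
    and convex_g: "convex_on {0..pi/2} g"
begin

lemma continuous_angle_cost: "continuous_on UNIV (angle_cost g)"
  unfolding angle_cost_def
proof (rule continuous_on_compose2[OF cont_g])
  show "continuous_on UNIV (\<lambda>t. arccos (max (- 1) (min 1 t)))"
    by (rule continuous_on_compose2[OF continuous_on_arccos'])
       (auto intro!: continuous_intros)
  show "range (\<lambda>t. arccos (max (- 1) (min 1 t))) \<subseteq> {0..pi}"
    by (auto intro!: arccos_lbound arccos_ubound)
qed

lemma angle_cost_measurable[measurable]: "angle_cost g \<in> borel_measurable borel"
  using continuous_angle_cost by (rule borel_measurable_continuous_onI)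

lemma angle_cost_strict_antimono:
  assumes "-1 \<le> s" "s < t" "t \<le> 1"
  shows "angle_cost g t < angle_cost g s"
  unfolding angle_cost_def using assms
  by (intro strict_mono_onD[OF mono_g]) (auto intro!: arccos_lbound arccos_ubound arccos_less_arccos)

lemma angle_cost_antimono:
  assumes "s \<le> t"
  shows "angle_cost g t \<le> angle_cost g s"
proof -
  \<comment> \<open>Clamping leaves the cost unchanged and brings both arguments into
    \<open>[-1, 1]\<close>, where strict monotonicity applies.\<close>
  define s' t' where "s' = max (-1) (min 1 s)" and "t' = max (-1) (min 1 t)"
  have "angle_cost g t = angle_cost g t'" "angle_cost g s = angle_cost g s'"
    by (simp_all add: angle_cost_def s'_def t'_def)
  moreover have "-1 \<le> s'" "t' \<le> 1" "s' \<le> t'"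
    using assms by (auto simp: s'_def t'_def)
  ultimately show ?thesis
    using angle_cost_strict_antimono[of s' t'] by (cases "s' = t'") auto
qed

lemma angle_cost_bounded: "\<bar>angle_cost g t\<bar> \<le> \<bar>angle_cost g (-1)\<bar> + \<bar>angle_cost g 1\<bar>"
proof -
  have "angle_cost g t = angle_cost g (max (-1) (min 1 t))" by (simp add: angle_cost_def)
  moreover have "angle_cost g 1 \<le> angle_cost g (max (-1) (min 1 t))"
    "angle_cost g (max (-1) (min 1 t)) \<le> angle_cost g (-1)"
    by (rule angle_cost_antimono, simp)+
  ultimately show ?thesis by linarith
qed

lemma angle_cost_less:
  fixes w w' x :: 'a
  assumes "norm w = 1" "norm w' = 1" "w \<bullet> x < w' \<bullet> x"
  shows "angle_cost g ((w' \<bullet> x) / norm x) < angle_cost g ((w \<bullet> x) / norm x)"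
proof (rule angle_cost_strict_antimono)
  have "x \<noteq> 0" using assms by auto
  then show "(w \<bullet> x) / norm x < (w' \<bullet> x) / norm x" using assms by (simp add: divide_strict_right_mono)
  show "- 1 \<le> (w \<bullet> x) / norm x" "(w' \<bullet> x) / norm x \<le> 1"
    using cosine_bound[of w x] cosine_bound[of w' x] assms by linarith+
qed

lemma angle_cost_le:
  fixes w w' x :: 'a
  assumes "w \<bullet> x \<le> w' \<bullet> x"
  shows "angle_cost g ((w' \<bullet> x) / norm x) \<le> angle_cost g ((w \<bullet> x) / norm x)"
  using assms by (intro angle_cost_antimono divide_right_mono) auto

lemma ball_part_measurable[measurable]: "K \<inter> ball 0 1 \<in> sets borel"
  using closed_K by auto

lemma integrable_cone_potential:
  "integrable lborel (\<lambda>x. indicator (K \<inter> ball 0 1) x * angle_cost g ((w \<bullet> x) / norm x))"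
proof (rule Bochner_Integration.integrable_bound[OF integrable_ball_const])
  show "(\<lambda>x. indicator (K \<inter> ball 0 1) x * angle_cost g ((w \<bullet> x) / norm x)) \<in> borel_measurable lborel"
    by measurable
  show "AE x in lborel. norm (indicator (K \<inter> ball 0 1) x * angle_cost g ((w \<bullet> x) / norm x))
      \<le> norm (indicator (ball 0 1) x * (\<bar>angle_cost g (-1)\<bar> + \<bar>angle_cost g 1\<bar>))"
    using angle_cost_bounded by (intro AE_I2) (auto simp: indicator_def)
qed

text \<open>Unfolding \<open>sphere_measure\<close> gives an integral over the ball with constant
  density. The radial projection of a nonzero \<open>x\<close> lies in \<open>K\<close> exactly if
  \<open>x\<close> does, because \<open>K\<close> is a cone.\<close>

lemma psi_eq_cone_potential:
  assumes w: "norm w = 1"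
  shows "psi K g w = cone_potential K g w / measure lborel (ball (0::'a) 1)"
proof -
  let ?B = "ball (0::'a) 1"
  define c where "c = measure lborel ?B"
  have em: "emeasure lborel ?B = ennreal c"
    unfolding c_def using emeasure_lborel_ball_finite[of "0::'a" 1]
    by (subst emeasure_eq_ennreal_measure) auto
  have "c > 0" unfolding c_def by (simp add: content_ball_pos)
  have [measurable]: "K \<inter> sphere 0 1 \<in> sets borel" "?B \<in> sets borel"
    using closed_K by auto
  have dens: "indicator ?B x / emeasure lborel ?B = ennreal (indicator ?B x / c)" for x
    using \<open>c > 0\<close> by (cases "x \<in> ?B") (auto simp: em divide_ennreal[symmetric])
  have "psi K g w = (\<integral>y. indicator (K \<inter> sphere 0 1) y * angle_cost g (w \<bullet> y) \<partial>sphere_measure)"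
    unfolding psi_def set_lebesgue_integral_def
  proof (rule Bochner_Integration.integral_cong[OF refl])
    fix y
    show "indicator (K \<inter> sphere 0 1) y *\<^sub>R g (geo_dist w y)
        = indicator (K \<inter> sphere 0 1) y * angle_cost g (w \<bullet> y)"
    proof (cases "y \<in> sphere 0 1")
      case True
      then have "\<bar>w \<bullet> y\<bar> \<le> 1" using cosine_bound[OF w, of y] by simp
      then have "max (-1) (min 1 (w \<bullet> y)) = w \<bullet> y" by auto
      then show ?thesis by (simp add: geo_dist_def angle_cost_def)
    qed auto
  qed
  also have "\<dots> = (\<integral>x. indicator (K \<inter> sphere 0 1) (x /\<^sub>R norm x) * angle_cost g (w \<bullet> (x /\<^sub>R norm x))
      \<partial>uniform_measure lborel ?B)"
    unfolding sphere_measure_def by (subst integral_distr) (auto simp: uniform_measure_def)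
  also have "\<dots> = (\<integral>x. (indicator ?B x / c) *
      (indicator (K \<inter> sphere 0 1) (x /\<^sub>R norm x) * angle_cost g (w \<bullet> (x /\<^sub>R norm x))) \<partial>lborel)"
    unfolding uniform_measure_def dens using \<open>c > 0\<close>
    by (subst integral_density) auto
  also have "\<dots> = (\<integral>x. (indicator (K \<inter> ?B) x * angle_cost g ((w \<bullet> x) / norm x)) / c \<partial>lborel)"
  proof (rule integral_cong_AE)
    show "AE x in lborel. (indicator ?B x / c) *
        (indicator (K \<inter> sphere 0 1) (x /\<^sub>R norm x) * angle_cost g (w \<bullet> (x /\<^sub>R norm x)))
      = (indicator (K \<inter> ?B) x * angle_cost g ((w \<bullet> x) / norm x)) / c"
      \<comment> \<open>The origin, whose projection \<open>x /\<^sub>R norm x\<close> is 0 and thus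
        off the sphere, is a null set.\<close>
      using AE_lborel_singleton[of "0::'a"]
    proof eventually_elim
      case (elim x)
      then have "x /\<^sub>R norm x \<in> K \<inter> sphere 0 1 \<longleftrightarrow> x \<in> K"
        using scale_mem_iff[of "inverse (norm x)" x] by auto
      then show ?case by (auto simp: indicator_def divide_inverse mult.commute)
    qed
  qed measurable
  finally show ?thesis by (simp add: cone_potential_def c_def)
qed

text \<open>Dominated convergence: the cost is continuous and bounded, and the ball has finite
  volume.\<close>

lemma continuous_cone_potential: "continuous_on UNIV (cone_potential K g)"
proof (rule continuous_on_sequentiallyI)
  fix u :: "nat \<Rightarrow> 'a" and a assume u: "u \<longlonglongrightarrow> a"
  let ?c = "\<bar>angle_cost g (-1)\<bar> + \<bar>angle_cost g 1\<bar>"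
  show "(\<lambda>n. cone_potential K g (u n)) \<longlonglongrightarrow> cone_potential K g a"
    unfolding cone_potential_def
  proof (rule integral_dominated_convergence[where w = "\<lambda>x. indicator (ball 0 1) x * ?c"])
    show "integrable lborel (\<lambda>x::'a. indicator (ball 0 1) x * ?c)" by (rule integrable_ball_const)
    show "AE x in lborel. (\<lambda>n. indicator (K \<inter> ball 0 1) x * angle_cost g ((u n \<bullet> x) / norm x))
        \<longlonglongrightarrow> indicator (K \<inter> ball 0 1) x * angle_cost g ((a \<bullet> x) / norm x)"
    proof (intro AE_I2 tendsto_mult_left)
      fix x
      have "(\<lambda>n. (u n \<bullet> x) / norm x) \<longlonglongrightarrow> (a \<bullet> x) / norm x"
        unfolding divide_inverse by (intro tendsto_intros u)
      then show "(\<lambda>n. angle_cost g ((u n \<bullet> x) / norm x)) \<longlonglongrightarrow> angle_cost g ((a \<bullet> x) / norm x)"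
        by (rule continuous_on_tendsto_compose[OF continuous_angle_cost]) auto
    qed
    show "AE x in lborel. norm (indicator (K \<inter> ball 0 1) x * angle_cost g ((u n \<bullet> x) / norm x))
        \<le> indicator (ball 0 1) x * ?c" for n
      using angle_cost_bounded by (intro AE_I2) (auto simp: indicator_def)
  qed measurable
qed

section \<open>Comparing the potential at two points of the sphere\<close>

text \<open>The comparison is pointwise: \<open>(w' - w) \<bullet> x\<close> is nonnegative on
  \<open>K\<close> and positive on its interior, and the cost decreases in the cosine.\<close>

lemma cone_potential_less_dual:
  assumes w: "norm w = 1" "norm w' = 1" and d: "w' - w \<in> dual_cone K" "w' \<noteq> w"
  shows "cone_potential K g w' < cone_potential K g w"
  unfolding cone_potential_def
proof (rule lborel_integral_strict_mono[OF integrable_cone_potential integrable_cone_potential])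
  show "open (interior K \<inter> ball 0 1)" by auto
  obtain x0 where "x0 \<in> interior K" using solid_K by auto
  moreover obtain c where "c > 0" "c *\<^sub>R x0 \<in> ball 0 1" by (rule small_scale_in_ball)
  ultimately show "interior K \<inter> ball 0 1 \<noteq> {}" using interior_scale by blast
next
  fix x
  show "indicator (K \<inter> ball 0 1) x * angle_cost g ((w' \<bullet> x) / norm x)
      \<le> indicator (K \<inter> ball 0 1) x * angle_cost g ((w \<bullet> x) / norm x)"
  proof (cases "x \<in> K")
    case True
    then have "w \<bullet> x \<le> w' \<bullet> x" using d by (auto simp: dual_cone_def inner_simps)
    then show ?thesis using angle_cost_le by (auto simp: indicator_def)
  qed auto
next
  fix x assume x: "x \<in> interior K \<inter> ball 0 1"
  then have "(w' - w) \<bullet> x > 0" using d by (intro dual_interior_pos) auto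
  then have "angle_cost g ((w' \<bullet> x) / norm x) < angle_cost g ((w \<bullet> x) / norm x)"
    using w by (intro angle_cost_less) (auto simp: inner_simps)
  moreover have "x \<in> K \<inter> ball 0 1" using x interior_subset by auto
  ultimately show "indicator (K \<inter> ball 0 1) x * angle_cost g ((w' \<bullet> x) / norm x)
      < indicator (K \<inter> ball 0 1) x * angle_cost g ((w \<bullet> x) / norm x)"
    by simp
qed

text \<open>The reflection \<open>R\<close> swapping \<open>w\<close> and \<open>w'\<close> changes the sign of the difference \<open>q\<close> of the two
  integrands, and \<open>v \<in> K\<close> makes it map the part of \<open>K\<close> nearer to \<open>w\<close> into the part nearer to
  \<open>w'\<close>. Hence symmetrising \<open>q\<close> over \<open>R\<close> gives a nonnegative integrand.\<close>
lemma cone_potential_less_interior: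
  assumes w: "norm w = 1" "norm w' = 1" and d: "w' - w \<in> interior K"
  shows "cone_potential K g w' < cone_potential K g w"
proof -
  define v where "v = w' - w"
  define R where "R x = x - (2 * (v \<bullet> x) / (v \<bullet> v)) *\<^sub>R v" for x
  have v: "v \<in> interior K" "v \<in> K" using d interior_subset by (auto simp: v_def)
  then have "v \<noteq> 0" using zero_not_interior by auto
  then have vv: "v \<bullet> v > 0" by simp
  have R: "orthogonal_transformation R"
    unfolding R_def by (rule reflection_orthogonal_transformation)
  have R_linear: "linear R" using R by (rule orthogonal_transformation_linear)
  then have R_cont: "continuous_on A R" for A
    by (simp add: linear_continuous_on linear_conv_bounded_linear)
  have R_meas[measurable]: "R \<in> borel_measurable borel"
    by (rule borel_measurable_continuous_onI[OF R_cont])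
  have normR: "norm (R x) = norm x" for x using R by (rule orthogonal_transformation_norm)
  \<comment> \<open>For unit vectors \<open>v \<bullet> v = - 2 * (v \<bullet> w)\<close>, so the
    reflection moves \<open>w\<close> by exactly \<open>v\<close>.\<close>
  have "v \<bullet> v = 2 * (1 - w \<bullet> w')" "v \<bullet> w = w \<bullet> w' - 1"
    using w by (simp_all add: v_def inner_simps inner_commute norm_eq_1)
  then have "2 * (v \<bullet> w) / (v \<bullet> v) = -1" using vv by (simp add: field_simps)
  then have Rw: "R w = w'" by (simp add: R_def v_def)
  have RR: "R (R x) = x" for x using vv by (simp add: R_def inner_simps)
  have Rw': "R w' = w" using RR[of w] Rw by simp
  have inner_R: "w \<bullet> R x = w' \<bullet> x" "w' \<bullet> R x = w \<bullet> x" for x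
    using R Rw Rw' RR unfolding orthogonal_transformation_def by metis+
  define D where "D = K \<inter> ball 0 1"
  define q where "q x = angle_cost g ((w \<bullet> x) / norm x) - angle_cost g ((w' \<bullet> x) / norm x)" for x
  have qR: "q (R x) = - q x" for x by (simp add: q_def inner_R normR)
  have [measurable]: "D \<in> sets borel" "q \<in> borel_measurable borel"
    unfolding D_def q_def by measurable
  have q_nonneg: "q x \<ge> 0" if "v \<bullet> x \<ge> 0" for x
    using that angle_cost_le[of w x w'] by (simp add: q_def v_def inner_simps)
  have q_pos: "q x > 0" if "v \<bullet> x > 0" for x
    using that angle_cost_less[of w w' x] w by (simp add: q_def v_def inner_simps)
  have int: "integrable lborel (\<lambda>x. indicator D x * q x)"
    unfolding q_def right_diff_distrib D_def
    by (intro Bochner_Integration.integrable_diff integrable_cone_potential)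
  have diff: "cone_potential K g w - cone_potential K g w' = (\<integral>x. indicator D x * q x \<partial>lborel)"
    unfolding cone_potential_def q_def right_diff_distrib D_def
    by (intro Bochner_Integration.integral_diff[symmetric] integrable_cone_potential)
  have intR: "integrable lborel (\<lambda>x. - (indicator D (R x) * q x))"
    using lborel_integral_orthogonal_transformation(2)[OF R, of "\<lambda>x. indicator D x * q x"] int
    by (simp add: qR)
  have diffR: "(\<integral>x. - (indicator D (R x) * q x) \<partial>lborel) = (\<integral>x. indicator D x * q x \<partial>lborel)"
    using lborel_integral_orthogonal_transformation(1)[OF R, of "\<lambda>x. indicator D x * q x"]
    by (simp add: qR)
  \<comment> \<open>\<open>x\<close> is \<open>R x\<close> plus a nonnegative multiple of
    \<open>v\<close>, a sum of two elements of the cone.\<close>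
  have D_towards: "x \<in> D" if "R x \<in> D" "v \<bullet> x \<ge> 0" for x
  proof -
    have "R x + (2 * (v \<bullet> x) / (v \<bullet> v)) *\<^sub>R v \<in> K"
      using that v vv by (intro add_mem scale_mem) (auto simp: D_def)
    then show ?thesis using that by (simp add: D_def R_def[of x]) (simp add: R_def[symmetric] normR)
  qed
  have nonneg: "0 \<le> indicator D x * q x + - (indicator D (R x) * q x)" for x
  proof (cases "v \<bullet> x \<ge> 0")
    case True
    then show ?thesis using D_towards[of x] q_nonneg[of x] by (auto simp: indicator_def)
  next
    case False
    have "v \<bullet> R x = - (v \<bullet> x)" using vv by (simp add: R_def inner_simps)
    then have *: "v \<bullet> R x \<ge> 0" using False by simp
    then have "q x \<le> 0" using q_nonneg[of "R x"] qR[of x] by simp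
    moreover have "R x \<in> D" if "x \<in> D" using D_towards[of "R x"] that * RR by simp
    ultimately show ?thesis by (auto simp: indicator_def)
  qed
  \<comment> \<open>On \<open>U\<close> the mirror image of \<open>x\<close> is outside
    \<open>K\<close>, so the symmetrised integrand reduces to \<open>q x\<close>, which is
    positive.\<close>
  define U where "U = (interior K \<inter> ball 0 1) \<inter> (R -` (- K)) \<inter> {x. v \<bullet> x > 0}"
  have "open U"
    unfolding U_def using closed_K
    by (intro open_Int open_vimage open_halfspace_gt R_cont open_interior open_ball open_Compl)
  have "U \<noteq> {}"
  proof -
    obtain c where c: "c > 0" "c *\<^sub>R v \<in> ball 0 1" by (rule small_scale_in_ball)
    have cv: "c *\<^sub>R v \<in> interior K" using v c interior_scale by blast
    \<comment> \<open>A short multiple of \<open>v\<close> lies in \<open>U\<close>, since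
      \<open>R\<close> negates it and the negative of an interior point is never in
      \<open>K\<close>.\<close>
    have "R (c *\<^sub>R v) = - (c *\<^sub>R v)"
      using vv by (simp add: R_def scaleR_2[symmetric] algebra_simps)
    then have "c *\<^sub>R v \<in> U"
      unfolding U_def using cv c vv minus_interior_not_mem[OF cv] by simp
    then show ?thesis by auto
  qed
  have pos: "0 < indicator D x * q x + - (indicator D (R x) * q x)" if "x \<in> U" for x
    using that q_pos[of x] interior_subset[of K] by (auto simp: U_def D_def indicator_def)
  have "(\<integral>x. 0 \<partial>(lborel :: 'a measure)) < (\<integral>x. indicator D x * q x + - (indicator D (R x) * q x) \<partial>lborel)"
    using int intR nonneg \<open>open U\<close> \<open>U \<noteq> {}\<close> pos
    by (intro lborel_integral_strict_mono[where U = U] Bochner_Integration.integrable_add) auto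
  also have "\<dots> = 2 * (cone_potential K g w - cone_potential K g w')"
    by (simp only: Bochner_Integration.integral_add[OF int intR] diffR diff)
  finally show ?thesis by simp
qed

section \<open>Location of the local minima outside the negative dual cone\<close>

lemma local_min_in_cone_and_dual:
  assumes w: "norm w = 1" and "e > 0"
    and min: "\<And>u. norm u = 1 \<Longrightarrow> dist u w < e \<Longrightarrow> cone_potential K g w \<le> cone_potential K g u"
    and nd: "w \<notin> uminus ` dual_cone K"
  shows "w \<in> dual_cone K" "w \<in> K"
proof -
  show dual: "w \<in> dual_cone K"
  proof (rule ccontr)
    assume "w \<notin> dual_cone K"
    then obtain v where "v \<in> K" "w \<bullet> v < 0" by (auto simp: dual_cone_def not_le)
    \<comment> \<open>The chord has to lie in the interior, so vectors of \<open>K\<close> on either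
      side of the hyperplane orthogonal to \<open>w\<close> are first moved into the
      interior.\<close>
    then obtain v' where v': "v' \<in> interior K" "w \<bullet> v' < 0"
      using open_meets_interior[OF open_halfspace_lt[where a = w and b = 0], of v] by auto
    have "- w \<notin> dual_cone K" using nd by (metis image_eqI minus_minus)
    then obtain u where "u \<in> K" "w \<bullet> u > 0" by (auto simp: dual_cone_def not_le)
    then obtain u' where u': "u' \<in> interior K" "w \<bullet> u' > 0"
      using open_meets_interior[OF open_halfspace_gt[where a = w and b = 0], of u] by auto
    obtain w' where w': "norm w' = 1" "dist w' w < e" "w' - w \<in> interior K"
    proof (rule short_chord_in_cone[of "interior K" u' w v' e])
      show "x + y \<in> interior K" if "x \<in> interior K" "y \<in> interior K" for x y
        using that interior_add interior_subset by blast
    qed (use u' v' w \<open>e > 0\<close> interior_scale zero_not_interior in auto)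
    show False
      using cone_potential_less_interior[OF w w'(1,3)] min[OF w'(1,2)] by simp
  qed
  show "w \<in> K"
  proof (rule ccontr)
    assume "w \<notin> K"
    then obtain v where v: "v \<in> dual_cone K" "w \<bullet> v < 0" by (rule separate_by_dual)
    obtain x0 where x0: "x0 \<in> interior K" using solid_K by auto
    \<comment> \<open>By the first part \<open>w\<close> is itself a dual vector, and it serves as
      the one with positive inner product with \<open>w\<close>.\<close>
    obtain w' where w': "norm w' = 1" "dist w' w < e" "w' - w \<in> dual_cone K - {0}"
    proof (rule short_chord_in_cone[of "dual_cone K - {0}" w w v e])
      show "x + y \<in> dual_cone K - {0}" if "x \<in> dual_cone K - {0}" "y \<in> dual_cone K - {0}" for x y
      proof -
        \<comment> \<open>Removing 0 keeps the cone closed under sums because nonzero dual vectors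
          are positive at the interior point \<open>x0\<close>.\<close>
        have "(x + y) \<bullet> x0 > 0"
          using that dual_interior_pos[OF _ _ x0] by (auto simp: inner_add_left intro!: add_pos_pos)
        then have "x + y \<noteq> 0" by auto
        then show ?thesis using that by (auto simp: dual_cone_def inner_add_left)
      qed
      show "c *\<^sub>R x \<in> dual_cone K - {0}" if "c > 0" "x \<in> dual_cone K - {0}" for c x
        using that by (auto simp: dual_cone_def)
      show "w \<in> dual_cone K - {0}" using dual w by auto
      show "w \<bullet> w > 0" using w by auto
      show "v \<in> dual_cone K - {0}" using v by auto
    qed (use v w \<open>e > 0\<close> in auto)
    then have "cone_potential K g w' < cone_potential K g w"
      using w by (intro cone_potential_less_dual) auto
    then show False using min[OF w'(1,2)] by simp
  qed
qed

section \<open>Convexity of the potential along geodesics\<close>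

text \<open>An increasing convex function of a convex function is convex; nonnegativity of the
  sinusoid keeps the angle in \<open>[0, pi/2]\<close>, where \<open>g\<close> is convex.\<close>

lemma angle_cost_sinusoid_convex:
  assumes ab: "a\<^sup>2 + b\<^sup>2 \<le> 1"
    and h: "\<And>t. t \<in> {s1..s2} \<Longrightarrow> 0 \<le> a * cos t + b * sin t \<and> a * cos t + b * sin t \<le> 1"
  shows "convex_on {s1..s2} (\<lambda>t. angle_cost g (a * cos t + b * sin t))"
proof (rule convex_onI)
  fix u x y :: real assume u: "0 < u" "u < 1" and xy: "x \<in> {s1..s2}" "y \<in> {s1..s2}"
  define z where "z = (1 - u) *\<^sub>R x + u *\<^sub>R y"
  have z: "z \<in> {s1..s2}" unfolding z_def using u xy by (intro convexD) auto
  define \<phi> where "\<phi> t = arccos (a * cos t + b * sin t)" for t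
  have cost: "angle_cost g (a * cos t + b * sin t) = g (\<phi> t)" if "t \<in> {s1..s2}" for t
    using h[OF that] by (simp add: angle_cost_def \<phi>_def)
  have range: "\<phi> t \<in> {0..pi/2}" if "t \<in> {s1..s2}" for t
    using h[OF that] arccos_lbound[of "a * cos t + b * sin t"] arccos_le_pi2[of "a * cos t + b * sin t"]
    by (auto simp: \<phi>_def)
  have "convex_on {s1..s2} \<phi>"
    unfolding \<phi>_def using convex_on_arccos_sinusoid[OF ab] h by blast
  then have le: "\<phi> z \<le> (1 - u) * \<phi> x + u * \<phi> y"
    unfolding z_def using u xy by (intro convex_onD) auto
  have mem: "(1 - u) *\<^sub>R \<phi> x + u *\<^sub>R \<phi> y \<in> {0..pi/2}"
    using u xy by (intro convexD range) auto
  have "g (\<phi> z) \<le> g ((1 - u) * \<phi> x + u * \<phi> y)"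
    using range[OF z] mem pi_gt_zero
    by (intro mono_onD[OF strict_mono_on_imp_mono_on[OF mono_g] _ _ le]) auto
  also have "\<dots> \<le> (1 - u) * g (\<phi> x) + u * g (\<phi> y)"
    using convex_onD[OF convex_g, of u "\<phi> x" "\<phi> y"] u range[OF xy(1)] range[OF xy(2)] by auto
  finally show "angle_cost g (a * cos ((1 - u) *\<^sub>R x + u *\<^sub>R y) + b * sin ((1 - u) *\<^sub>R x + u *\<^sub>R y))
    \<le> (1 - u) * angle_cost g (a * cos x + b * sin x) + u * angle_cost g (a * cos y + b * sin y)"
    using cost[OF z] cost[OF xy(1)] cost[OF xy(2)] by (simp add: z_def)
qed simp

text \<open>On the dual cone all distances to \<open>K\<close> are at most \<open>\<pi>/2\<close>, so the potential is convex along
  the geodesic from \<open>w0\<close> to \<open>w1\<close>. At its midpoint \<open>m\<close> convexity is strict: \<open>m \<in> K\<close>, and points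
  of \<open>K\<close> close to \<open>m\<close> are nearer to \<open>m\<close> than to either end.\<close>
lemma local_min_less:
  assumes w0: "norm w0 = 1" "w0 \<in> K" "w0 \<in> dual_cone K"
    and w1: "norm w1 = 1" "w1 \<in> K" "w1 \<in> dual_cone K" and ne: "w0 \<noteq> w1"
    and "e > 0"
    and min: "\<And>u. norm u = 1 \<Longrightarrow> dist u w0 < e \<Longrightarrow> cone_potential K g w0 \<le> cone_potential K g u"
  shows "cone_potential K g w0 < cone_potential K g w1"
proof -
  define \<theta> where "\<theta> = arccos (w0 \<bullet> w1)"
  have w00: "w0 \<bullet> w0 = 1" and w11: "w1 \<bullet> w1 = 1" using w0 w1 by (simp_all add: norm_eq_1)
  have "0 \<le> w0 \<bullet> w1" using w0 w1 by (simp add: dual_cone_def)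
  have "(w0 - w1) \<bullet> (w0 - w1) > 0" using ne by simp
  then have "w0 \<bullet> w1 < 1" using w00 w11 by (simp add: inner_simps inner_commute)
  have cos\<theta>: "cos \<theta> = w0 \<bullet> w1"
    using \<open>0 \<le> w0 \<bullet> w1\<close> \<open>w0 \<bullet> w1 < 1\<close> by (simp add: \<theta>_def)
  have \<theta>: "0 < \<theta>" "\<theta> \<le> pi / 2"
    using \<open>0 \<le> w0 \<bullet> w1\<close> \<open>w0 \<bullet> w1 < 1\<close> arccos_less_arccos[of "w0 \<bullet> w1" 1]
      arccos_le_pi2[of "w0 \<bullet> w1"]
    by (auto simp: \<theta>_def)
  have sin\<theta>: "sin \<theta> > 0" using \<theta> pi_gt_zero by (intro sin_gt_zero) linarith+
  \<comment> \<open>The unit tangent vector at \<open>w0\<close> pointing to \<open>w1\<close>;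
    \<open>\<gamma>\<close> below is then the great circle with \<open>\<gamma> 0 = w0\<close> and
    \<open>\<gamma> \<theta> = w1\<close>.\<close>
  define n where "n = (w1 - cos \<theta> *\<^sub>R w0) /\<^sub>R sin \<theta>"
  have w0n: "w0 \<bullet> n = 0" by (simp add: n_def inner_simps w00 cos\<theta>)
  have "(w1 - cos \<theta> *\<^sub>R w0) \<bullet> (w1 - cos \<theta> *\<^sub>R w0) = 1 - (cos \<theta>)\<^sup>2"
    by (simp add: inner_simps w00 w11 cos\<theta> inner_commute power2_eq_square)
  also have "\<dots> = sin \<theta> * sin \<theta>" using sin_cos_squared_add[of \<theta>] by (simp add: power2_eq_square)
  finally have nn: "n \<bullet> n = 1" using sin\<theta> unfolding n_def
    by (simp only: inner_scaleR_left inner_scaleR_right) (simp add: field_simps)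
  define \<gamma> where "\<gamma> t = cos t *\<^sub>R w0 + sin t *\<^sub>R n" for t
  have norm\<gamma>: "norm (\<gamma> t) = 1" for t
    using sin_cos_squared_add[of t] w0n nn w00
    by (simp add: norm_eq_1 \<gamma>_def inner_simps inner_commute power2_eq_square)
  have \<gamma>0: "\<gamma> 0 = w0" by (simp add: \<gamma>_def)
  have \<gamma>\<theta>: "\<gamma> \<theta> = w1" using sin\<theta> by (simp add: \<gamma>_def n_def)
  \<comment> \<open>Spherical interpolation: between the ends both coefficients are nonnegative, so
    the arc stays in \<open>K\<close> and in the dual cone.\<close>
  have \<gamma>_eq: "\<gamma> t = (sin (\<theta> - t) / sin \<theta>) *\<^sub>R w0 + (sin t / sin \<theta>) *\<^sub>R w1" for t
  proof -
    have "sin (\<theta> - t) / sin \<theta> = cos t - sin t * cos \<theta> / sin \<theta>"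
      using sin\<theta> by (simp add: sin_diff field_simps)
    then show ?thesis
      by (simp only:) (simp add: \<gamma>_def n_def algebra_simps divide_inverse)
  qed
  have coeff: "sin (\<theta> - t) / sin \<theta> \<ge> 0" "sin t / sin \<theta> \<ge> 0" if "t \<in> {0..\<theta>}" for t
    using that \<theta> sin\<theta> pi_gt_zero by (auto intro!: divide_nonneg_pos sin_ge_zero)
  have \<gamma>_pos: "\<gamma> t \<bullet> x \<ge> 0" if "t \<in> {0..\<theta>}" "x \<in> K" for t x
    using coeff[OF that(1)] that(2) w0 w1
    by (auto simp: \<gamma>_eq inner_simps dual_cone_def intro!: add_nonneg_nonneg mult_nonneg_nonneg
        simp del: times_divide_eq_left)
  have \<gamma>_K: "\<gamma> t \<in> K" if "t \<in> {0..\<theta>}" for t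
    unfolding \<gamma>_eq using coeff[OF that] w0 w1 by (intro add_mem scale_mem)
  have \<gamma>_inner: "(\<gamma> t \<bullet> x) / norm x = (w0 \<bullet> x) / norm x * cos t + (n \<bullet> x) / norm x * sin t" for t x
    by (simp add: \<gamma>_def inner_simps add_divide_distrib mult.commute)
  \<comment> \<open>Bessel's inequality for the orthonormal pair \<open>w0\<close>, \<open>n\<close>
    bounds the amplitude of the sinusoid \<open>\<gamma>_inner\<close>.\<close>
  have bessel: "((w0 \<bullet> x) / norm x)\<^sup>2 + ((n \<bullet> x) / norm x)\<^sup>2 \<le> 1" for x
  proof (cases "x = 0")
    case False
    have "0 \<le> (x - (w0 \<bullet> x) *\<^sub>R w0 - (n \<bullet> x) *\<^sub>R n) \<bullet> (x - (w0 \<bullet> x) *\<^sub>R w0 - (n \<bullet> x) *\<^sub>R n)"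
      by simp
    also have "\<dots> = x \<bullet> x - (w0 \<bullet> x)\<^sup>2 - (n \<bullet> x)\<^sup>2"
      using w0n by (simp add: inner_simps w00 nn inner_commute[of n w0] inner_commute[of x w0] inner_commute[of x n]
          power2_eq_square algebra_simps)
    finally show ?thesis using False
      by (simp add: power_divide add_divide_distrib[symmetric] power2_norm_eq_inner)
  qed simp
  let ?F = "\<lambda>t x. indicator (K \<inter> ball 0 1) x * angle_cost g ((\<gamma> t \<bullet> x) / norm x)"
  have int: "integrable lborel (?F t)" for t by (rule integrable_cone_potential)
  have F: "cone_potential K g (\<gamma> t) = (\<integral>x. ?F t x \<partial>lborel)" for t by (simp add: cone_potential_def)
  have conv: "convex_on {0..\<theta>} (\<lambda>t. angle_cost g ((\<gamma> t \<bullet> x) / norm x))" if "x \<in> K" for x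
    unfolding \<gamma>_inner
  proof (rule angle_cost_sinusoid_convex[OF bessel], unfold \<gamma>_inner[symmetric], intro conjI)
    fix t assume "t \<in> {0..\<theta>}"
    then show "0 \<le> (\<gamma> t \<bullet> x) / norm x" using \<gamma>_pos that by simp
    show "(\<gamma> t \<bullet> x) / norm x \<le> 1" using cosine_bound[OF norm\<gamma>, of t x] by linarith
  qed
  have F_conv: "?F ((1 - u) * s + u * t) x \<le> (1 - u) * ?F s x + u * ?F t x"
    if "u \<in> {0..1}" "s \<in> {0..\<theta>}" "t \<in> {0..\<theta>}" for u s t x
    using convex_onD[OF conv[of x], of u s t] that by (auto simp: indicator_def)
  define m where "m = \<gamma> (\<theta> / 2)"
  have m: "norm m = 1" "m \<in> K" unfolding m_def using norm\<gamma> \<gamma>_K \<theta> by auto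
  have "cos (\<theta> / 2) < 1" using cos_monotone_0_pi[of 0 "\<theta> / 2"] \<theta> pi_gt_zero by simp
  have "w0 \<bullet> m = cos (\<theta> / 2)" by (simp add: m_def \<gamma>_def inner_simps w00 w0n)
  moreover have "w1 \<bullet> m = cos (\<theta> - \<theta> / 2)"
    unfolding m_def \<gamma>\<theta>[symmetric] cos_diff
    by (simp add: \<gamma>_def inner_simps w00 w0n nn inner_commute[of n w0])
  ultimately have wm: "w0 \<bullet> m < 1" "w1 \<bullet> m < 1" using \<open>cos (\<theta> / 2) < 1\<close> by simp_all
  have mm: "m \<bullet> m = 1" using m by (simp add: norm_eq_1)
  \<comment> \<open>Points of the ball making a smaller angle with \<open>m\<close> than with
    \<open>w0\<close> and with \<open>w1\<close>. The set contains \<open>m / 2\<close>, an element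
    of \<open>K\<close>, and therefore meets \<open>interior K\<close>.\<close>
  let ?V = "{x. (m - w0) \<bullet> x > 0} \<inter> {x. (m - w1) \<bullet> x > 0} \<inter> ball 0 1"
  have "open ?V" by (intro open_Int open_halfspace_gt open_ball)
  have "(1/2) *\<^sub>R m \<in> ?V" using mm wm m by (simp add: inner_diff_left)
  then have "?V \<inter> interior K \<noteq> {}"
    using open_meets_interior[OF \<open>open ?V\<close> scale_mem[OF m(2), of "1/2"]] by simp
  have mid: "cone_potential K g m < (cone_potential K g w0 + cone_potential K g w1) / 2"
  proof -
    have "(\<integral>x. ?F (\<theta> / 2) x \<partial>lborel) < (\<integral>x. 1/2 * ?F 0 x + 1/2 * ?F \<theta> x \<partial>lborel)"
    proof (rule lborel_integral_strict_mono[OF int _ _ _ \<open>?V \<inter> interior K \<noteq> {}\<close>])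
      show "integrable lborel (\<lambda>x. 1/2 * ?F 0 x + 1/2 * ?F \<theta> x)"
        by (intro Bochner_Integration.integrable_add integrable_mult_right int)
      show "open (?V \<inter> interior K)" using \<open>open ?V\<close> by auto
      show "?F (\<theta> / 2) x \<le> 1/2 * ?F 0 x + 1/2 * ?F \<theta> x" for x
        using F_conv[of "1/2" 0 \<theta> x] \<theta> by simp
      fix x assume x: "x \<in> ?V \<inter> interior K"
      then have "x \<in> K \<inter> ball 0 1" using interior_subset by blast
      moreover have "angle_cost g ((m \<bullet> x) / norm x) < angle_cost g ((w0 \<bullet> x) / norm x)"
        "angle_cost g ((m \<bullet> x) / norm x) < angle_cost g ((w1 \<bullet> x) / norm x)"
        using x w0 w1 m by (auto intro!: angle_cost_less simp: inner_diff_left)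
      ultimately show "?F (\<theta> / 2) x < 1/2 * ?F 0 x + 1/2 * ?F \<theta> x"
        by (simp add: \<gamma>0 \<gamma>\<theta> m_def[symmetric])
    qed
    also have "\<dots> = 1/2 * (\<integral>x. ?F 0 x \<partial>lborel) + 1/2 * (\<integral>x. ?F \<theta> x \<partial>lborel)"
      by (subst Bochner_Integration.integral_add) (simp_all add: int)
    finally show ?thesis unfolding F[symmetric] by (simp add: m_def \<gamma>0 \<gamma>\<theta>)
  qed
  \<comment> \<open>For small \<open>u\<close> local minimality applies at the fraction
    \<open>u\<close> of the arc from \<open>w0\<close> to \<open>m\<close>, where by convexity the
    potential is at most \<open>1 - u\<close> times its value at \<open>w0\<close> plus
    \<open>u\<close> times its value at \<open>m\<close>.\<close>
  have "cone_potential K g w0 \<le> cone_potential K g m"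
  proof -
    have "((\<lambda>u. dist (\<gamma> (u * (\<theta> / 2))) w0) \<longlongrightarrow> dist (\<gamma> (0 * (\<theta> / 2))) w0) (at_right 0)"
      unfolding \<gamma>_def by (intro tendsto_intros)
    then have "\<forall>\<^sub>F u in at_right 0. dist (\<gamma> (u * (\<theta> / 2))) w0 < e"
      using \<open>e > 0\<close> by (intro order_tendstoD) (auto simp: \<gamma>0)
    moreover have "\<forall>\<^sub>F u in at_right (0::real). u > 0 \<and> u < 1"
      using eventually_at_right_real[of 0 1] by (auto elim: eventually_mono)
    ultimately have "\<forall>\<^sub>F u in at_right 0. dist (\<gamma> (u * (\<theta> / 2))) w0 < e \<and> u > 0 \<and> u < 1"
      by eventually_elim auto
    then obtain u where u: "dist (\<gamma> (u * (\<theta> / 2))) w0 < e" "u > 0" "u < 1"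
      using eventually_happens[of _ "at_right (0::real)"] by auto
    have "cone_potential K g w0 \<le> cone_potential K g (\<gamma> (u * (\<theta> / 2)))"
      using min norm\<gamma> u by simp
    also have "\<dots> \<le> (\<integral>x. (1 - u) * ?F 0 x + u * ?F (\<theta> / 2) x \<partial>lborel)"
      unfolding F
    proof (rule integral_mono)
      show "integrable lborel (\<lambda>x. (1 - u) * ?F 0 x + u * ?F (\<theta> / 2) x)"
        by (intro Bochner_Integration.integrable_add integrable_mult_right int)
      show "?F (u * (\<theta> / 2)) x \<le> (1 - u) * ?F 0 x + u * ?F (\<theta> / 2) x" for x
        using F_conv[of u 0 "\<theta> / 2" x] u \<theta> by simp
    qed (rule int)
    also have "\<dots> = (1 - u) * (\<integral>x. ?F 0 x \<partial>lborel) + u * (\<integral>x. ?F (\<theta> / 2) x \<partial>lborel)"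
      by (subst Bochner_Integration.integral_add) (simp_all add: int)
    also have "\<dots> = (1 - u) * cone_potential K g w0 + u * cone_potential K g m"
      unfolding F[symmetric] by (simp add: m_def \<gamma>0)
    finally have "u * cone_potential K g w0 \<le> u * cone_potential K g m" by (simp add: algebra_simps)
    then show ?thesis using u by simp
  qed
  with mid show ?thesis by simp
qed

section \<open>Existence and uniqueness of the minimum\<close>

lemma psi_le_iff:
  assumes "norm u = 1" "norm w = 1"
  shows "psi K g w \<le> psi K g u \<longleftrightarrow> cone_potential K g w \<le> cone_potential K g u"
  using assms content_ball_pos[of 1 "0::'a"] by (simp add: psi_eq_cone_potential divide_le_cancel)

text \<open>Two distinct such points would both lie in \<open>K\<close> and its dual, and
  \<open>local_min_less\<close>, applied in both directions, would make each value smaller than the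
  other.\<close>

lemma local_min_unique:
  assumes w: "sphere_local_min (psi K g) w" "w \<notin> uminus ` dual_cone K"
    and w': "sphere_local_min (psi K g) w'" "w' \<notin> uminus ` dual_cone K"
  shows "w = w'"
proof (rule ccontr)
  assume ne: "w \<noteq> w'"
  have ex: "\<exists>e>0. \<forall>u. norm u = 1 \<longrightarrow> dist u w < e \<longrightarrow> cone_potential K g w \<le> cone_potential K g u"
    and norm1: "norm w = 1" if "sphere_local_min (psi K g) w" for w
    using that psi_le_iff by (auto simp: sphere_local_min_def)
  obtain e where e: "e > 0"
    "\<And>u. norm u = 1 \<Longrightarrow> dist u w < e \<Longrightarrow> cone_potential K g w \<le> cone_potential K g u"
    using ex[OF w(1)] by auto
  obtain e' where e': "e' > 0"
    "\<And>u. norm u = 1 \<Longrightarrow> dist u w' < e' \<Longrightarrow> cone_potential K g w' \<le> cone_potential K g u"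
    using ex[OF w'(1)] by auto
  note n = norm1[OF w(1)] norm1[OF w'(1)]
  note c = local_min_in_cone_and_dual[OF n(1) e w(2)]
    and c' = local_min_in_cone_and_dual[OF n(2) e' w'(2)]
  have "cone_potential K g w < cone_potential K g w'"
    using n c c' ne e by (intro local_min_less[of w w' e]) auto
  moreover have "cone_potential K g w' < cone_potential K g w"
    using n c c' ne e' by (intro local_min_less[of w' w e']) auto
  ultimately show False by simp
qed

lemma global_min_exists: "\<exists>w. sphere_global_min (psi K g) w"
proof -
  have "continuous_on (sphere 0 1) (cone_potential K g)"
    using continuous_cone_potential continuous_on_subset by blast
  then obtain w where "w \<in> sphere 0 1" "\<forall>u\<in>sphere 0 1. cone_potential K g w \<le> cone_potential K g u"
    using continuous_attains_inf[of "sphere 0 1" "cone_potential K g"] by auto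
  then show ?thesis unfolding sphere_global_min_def using psi_le_iff by auto
qed

lemma global_min_not_in_neg_dual:
  assumes "sphere_global_min (psi K g) w"
  shows "w \<notin> uminus ` dual_cone K"
proof
  assume "w \<in> uminus ` dual_cone K"
  then have "- w - w \<in> dual_cone K" by (auto simp: dual_cone_def inner_simps)
  moreover have w: "norm w = 1" using assms by (simp add: sphere_global_min_def)
  moreover have "- w \<noteq> w"
  proof
    assume "- w = w"
    then have "2 *\<^sub>R w = 0" using left_minus[of w] by (simp add: scaleR_2)
    then show False using w by simp
  qed
  ultimately have "cone_potential K g (- w) < cone_potential K g w"
    by (intro cone_potential_less_dual) auto
  moreover have "psi K g w \<le> psi K g (- w)" using assms by (auto simp: sphere_global_min_def)
  ultimately show False using psi_le_iff[of "- w" w] w by simp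
qed

end

theorem mainTheorem6:
  fixes K :: "'a::euclidean_space set" and g :: "real \<Rightarrow> real"
  assumes "closed K" and "convex_cone K" and "proper_cone K" and "interior K \<noteq> {}"
    and "continuous_on {0..pi} g" and "strict_mono_on {0..pi} g"
    and "convex_on {0..pi/2} g"
  shows "\<exists>w0. sphere_global_min (psi K g) w0
              \<and> (\<forall>w. sphere_global_min (psi K g) w \<longrightarrow> w = w0)
              \<and> w0 \<notin> uminus ` dual_cone K
              \<and> (\<forall>w. sphere_local_min (psi K g) w \<and> w \<notin> uminus ` dual_cone K \<longrightarrow> w = w0)"
proof -
  interpret cone_potential_setup K g by unfold_locales (use assms in auto)
  have local: "sphere_local_min (psi K g) w" if "sphere_global_min (psi K g) w" for w
    using that by (auto simp: sphere_global_min_def sphere_local_min_def intro: exI[of _ 1])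
  obtain w0 where w0: "sphere_global_min (psi K g) w0" using global_min_exists by blast
  note w0_outside = global_min_not_in_neg_dual[OF w0]
  \<comment> \<open>This covers both uniqueness claims, as every global minimum is a local one
    outside the negative dual cone.\<close>
  have unique: "w = w0" if "sphere_local_min (psi K g) w" "w \<notin> uminus ` dual_cone K" for w
    using local_min_unique[OF that local[OF w0] w0_outside] .
  show ?thesis
  proof (intro exI[of _ w0] conjI allI impI)
    show "w = w0" if "sphere_global_min (psi K g) w" for w
      using unique[OF local[OF that] global_min_not_in_neg_dual[OF that]] .
    show "w = w0" if "sphere_local_min (psi K g) w \<and> w \<notin> uminus ` dual_cone K" for w
      using unique that by blast
  qed (rule w0 w0_outside)+
qed

end
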